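(* There is an absolute constant $C$ such that for every integer $k\ge1$ there exists $\vec a\in\mathcal P(k)$ with \[\chi(\vec a)+\|\vec a\|\ \le\ \tfrac13\log_\varphi(k)+C,\] where $\varphi=(\sqrt5+1)/2$ is the golden ratio.
   Context: For an integer $k\ge1$, $\mathcal P(k)$ is the set of sequences $\vec a=(a_0,\dots,a_k)\in[0,1]^{\{0,\dots,k\}}$ with $\|\vec a\|:=a_0+\dots+a_k\ge1$; $\vec a\le\vec b$ means $a_h\le b_h$ for all $h$. The complexity measure $\chi:\bigcup_{k\ge1}\mathcal P(k)\to\mathbb R_{\ge0}$ is defined inductively: $\chi(a_0,a_1)=0$; for $k\ge2$, $\chi(a_0,\dots,a_k)$ is the minimum, over integers $0<i\le j<k$ and $\vec b\in\mathcal P(k)$ with $\vec a\le\vec b$, $(b_0,\dots,b_j)\in\mathcal P(j)$ and $(b_i,\dots,b_k)\in\mathcal P(k-i)$, of $\|\vec b-\vec a\|+\max\{\chi(b_0,\dots,b_j),\chi(b_i,\dots,b_k)\}$. *)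

theory Defs
  imports "HOL-Analysis.Analysis" "HOL-Library.Infinite_Set"
begin

definition golden_ratio :: real where
  "golden_ratio = (sqrt 5 + 1) / 2"

text \<open>
  A sequence \<open>(a\<^sub>0, \<dots>, a\<^sub>k)\<close> is represented by a list of length \<open>k + 1\<close>, so the list determines \<open>k\<close>.
  All sequences in question are nonnegative, and \<open>sum_list\<close> plays the role of \<open>\<parallel>\<cdot>\<parallel>\<close>.
\<close>

definition \<P> :: "nat \<Rightarrow> real list set" where
  "\<P> k = {a. length a = Suc k \<and> set a \<subseteq> {0..1} \<and> sum_list a \<ge> 1}"

text \<open>
  The triples \<open>(i, j, b)\<close> over which the minimum is taken. Here \<open>take (Suc j) b\<close> is
  \<open>(b\<^sub>0, \<dots>, b\<^sub>j)\<close> and \<open>drop i b\<close> is \<open>(b\<^sub>i, \<dots>, b\<^sub>k)\<close>.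
\<close>

definition splits :: "real list \<Rightarrow> (nat \<times> nat \<times> real list) set" where
  "splits a = (let k = length a - 1 in
     {(i, j, b). 0 < i \<and> i \<le> j \<and> j < k \<and> b \<in> \<P> k \<and> list_all2 (\<le>) a b \<and>
        take (Suc j) b \<in> \<P> j \<and> drop i b \<in> \<P> (k - i)})"

text \<open>
  The infimum below is a minimum whenever \<open>a \<in> \<P> k\<close>, see \<open>chi_minimum\<close>. On lists lying in
  no \<open>\<P> k\<close> with \<open>k \<ge> 1\<close> the value of \<open>chi\<close> is meaningless.
\<close>

function chi :: "real list \<Rightarrow> real" where
  "chi a = (if length a \<le> 2 then 0
     else INF (i, j, b)\<in>splits a.
       sum_list (map2 (-) b a) + max (chi (take (Suc j) b)) (chi (drop i b)))"
  by pat_completeness auto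
termination
  by (relation "Wellfounded.measure length") (auto simp: splits_def Let_def \<P>_def)

declare chi.simps [simp del]

definition split_cost :: "real list \<Rightarrow> nat \<times> nat \<times> real list \<Rightarrow> real" where
  "split_cost a = (\<lambda>(i, j, b).
     sum_list (map2 (-) b a) + max (chi (take (Suc j) b)) (chi (drop i b)))"

lemma chi_base: "a \<in> \<P> 1 \<Longrightarrow> chi a = 0"
  by (simp add: chi.simps \<P>_def)

lemma chi_step: "a \<in> \<P> k \<Longrightarrow> k \<ge> 2 \<Longrightarrow> chi a = (INF s\<in>splits a. split_cost a s)"
  by (subst chi.simps) (simp add: \<P>_def split_cost_def)

lemma splits_iff:
  assumes "a \<in> \<P> k"
  shows "(i, j, b) \<in> splits a \<longleftrightarrow> 0 < i \<and> i \<le> j \<and> j < k \<and> b \<in> \<P> k \<and> list_all2 (\<le>) a b \<and>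
           take (Suc j) b \<in> \<P> j \<and> drop i b \<in> \<P> (k - i)"
  using assms by (auto simp: splits_def \<P>_def)

lemma PP_iff:
  "a \<in> \<P> k \<longleftrightarrow> length a = Suc k \<and> (\<forall>h<Suc k. 0 \<le> a ! h \<and> a ! h \<le> 1) \<and> (\<Sum>h<Suc k. a ! h) \<ge> 1"
  by (auto simp: \<P>_def subset_iff all_set_conv_all_nth sum_list_sum_nth lessThan_atLeast0)
     (metis in_set_conv_nth)+

lemma sum_list_map2_diff:
  assumes "length a = Suc k" "length b = Suc k"
  shows "sum_list (map2 (-) b a) = (\<Sum>h<Suc k. b ! h - a ! h :: real)"
  using assms by (simp add: sum_list_sum_nth lessThan_atLeast0)

lemma splits_nonempty:
  assumes a: "a \<in> \<P> k" and k: "k \<ge> 2"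
  shows "splits a \<noteq> {}"
proof -
  have "(1, 1, replicate (Suc k) 1) \<in> splits a"
    using a k by (auto simp: splits_iff[OF a] PP_iff list_all2_conv_all_nth drop_replicate take_replicate min_def
        simp del: replicate_Suc)
  then show ?thesis by blast
qed

lemma split_cost_ge:
  assumes a: "a \<in> \<P> k" and s: "(i, j, b) \<in> splits a"
  shows "max (chi (take (Suc j) b)) (chi (drop i b)) \<le> split_cost a (i, j, b)"
proof -
  have "length a = Suc k" "length b = Suc k" "list_all2 (\<le>) a b"
    using a s by (auto simp: splits_iff[OF a] \<P>_def)
  then have "0 \<le> sum_list (map2 (-) b a)"
    by (subst sum_list_map2_diff[of _ k]) (auto intro!: sum_nonneg simp: list_all2_conv_all_nth simp del: sum.lessThan_Suc)
  then show ?thesis by (simp add: split_cost_def)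
qed

lemma chi_nonneg: "a \<in> \<P> k \<Longrightarrow> k \<ge> 1 \<Longrightarrow> 0 \<le> chi a"
proof (induction k arbitrary: a rule: less_induct)
  case (less k)
  show ?case
  proof (cases "k = 1")
    case True
    then show ?thesis using less.prems chi_base by force
  next
    case False
    then have k: "k \<ge> 2" using less.prems by simp
    have "0 \<le> split_cost a s" if s: "s \<in> splits a" for s
    proof -
      obtain i j b where [simp]: "s = (i, j, b)" by (cases s)
      have "0 \<le> chi (take (Suc j) b)"
        using s less.prems by (intro less.IH[of j]) (auto simp: splits_iff)
      then show ?thesis using split_cost_ge[of a k i j b] s less.prems by auto
    qed
    then show ?thesis
      using splits_nonempty less.prems k by (subst chi_step[of _ k]) (auto intro!: cINF_greatest)
  qed
qed

lemma chi_le: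
  assumes a: "a \<in> \<P> k" and k: "k \<ge> 2" and s: "s \<in> splits a"
  shows "chi a \<le> split_cost a s"
proof -
  have "0 \<le> split_cost a t" if t: "t \<in> splits a" for t
  proof -
    obtain i j b where [simp]: "t = (i, j, b)" by (cases t)
    have "0 \<le> chi (take (Suc j) b)"
      using t a by (intro chi_nonneg[of _ j]) (auto simp: splits_iff)
    then show ?thesis using split_cost_ge[of a k i j b] t a by auto
  qed
  then have "bdd_below (split_cost a ` splits a)"
    by (intro bdd_belowI2[of _ 0]) auto
  then show ?thesis using s chi_step[OF a k] by (auto intro: cINF_lower)
qed

text \<open>
  That the minimum is attained follows by induction from compactness and from lower
  semicontinuity of \<open>chi\<close>, the latter in the following form.
\<close>

definition chi_lsc :: "nat \<Rightarrow> bool" where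
  "chi_lsc k \<longleftrightarrow> (\<forall>A a c cl. (\<forall>n::nat. A n \<in> \<P> k \<and> chi (A n) \<le> c n) \<longrightarrow> a \<in> \<P> k \<longrightarrow>
     (\<forall>h<Suc k. (\<lambda>n. A n ! h) \<longlonglongrightarrow> a ! h) \<longrightarrow> c \<longlonglongrightarrow> cl \<longrightarrow> chi a \<le> cl)"

lemma chi_lscD:
  assumes "chi_lsc k" "\<And>n::nat. A n \<in> \<P> k" "\<And>n. chi (A n) \<le> c n" "a \<in> \<P> k"
    "\<And>h. h < Suc k \<Longrightarrow> (\<lambda>n. A n ! h) \<longlonglongrightarrow> a ! h" "c \<longlonglongrightarrow> cl"
  shows "chi a \<le> cl"
  using assms(1)[unfolded chi_lsc_def, rule_format, of A c a cl] assms(2-) by blast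

lemma coordinatewise_convergent_subseq:
  fixes B :: "nat \<Rightarrow> nat \<Rightarrow> real"
  assumes "\<And>n h. h < m \<Longrightarrow> 0 \<le> B n h \<and> B n h \<le> 1"
  shows "\<exists>r. strict_mono r \<and> (\<forall>h<m. convergent (\<lambda>n. B (r n) h))"
  using assms
proof (induction m)
  case 0
  show ?case by (rule exI[of _ id]) (simp add: strict_mono_def)
next
  case (Suc m)
  then obtain r where r: "strict_mono r" "\<And>h. h < m \<Longrightarrow> convergent (\<lambda>n. B (r n) h)"
    by (metis less_SucI)
  obtain l s where s: "strict_mono (s :: nat \<Rightarrow> nat)" "((\<lambda>n. B (r n) m) \<circ> s) \<longlonglongrightarrow> l"
    using Suc.prems[of m] compact_Icc[of "0::real" 1, unfolded compact_def]
    by (metis atLeastAtMost_iff lessI)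
  have "convergent (\<lambda>n. B ((r \<circ> s) n) h)" if h: "h < Suc m" for h
  proof (cases "h = m")
    case True
    then show ?thesis using s by (auto simp: convergent_def o_def)
  next
    case False
    then show ?thesis
      using h r(2)[of h] s(1) convergent_subseq_convergent[of "\<lambda>n. B (r n) h" s]
      by (simp add: o_def)
  qed
  then show ?case using r(1) s(1) strict_mono_o by blast
qed

lemma constant_subseq:
  fixes f :: "nat \<Rightarrow> 'a"
  assumes "finite (range f)"
  shows "\<exists>r x. strict_mono r \<and> (\<forall>n::nat. f (r n) = x)"
proof -
  obtain n0 where n0: "infinite {n. f n = f n0}"
    using pigeonhole_infinite[of UNIV f] assms by auto
  then show ?thesis
    using strict_mono_enumerate[OF n0] enumerate_in_set[OF n0] by blast
qed

lemma splits_closed: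
  assumes lsc: "\<And>m. 1 \<le> m \<Longrightarrow> m < k \<Longrightarrow> chi_lsc m"
    and A: "\<And>n::nat. A n \<in> \<P> k" and a: "a \<in> \<P> k"
    and s: "\<And>n. s n \<in> splits (A n)" "\<And>n. split_cost (A n) (s n) \<le> c n"
    and Aa: "\<And>h. h < Suc k \<Longrightarrow> (\<lambda>n. A n ! h) \<longlonglongrightarrow> a ! h" and c: "c \<longlonglongrightarrow> cl"
  shows "\<exists>t\<in>splits a. split_cost a t \<le> cl"
proof -
  define I where "I n = fst (s n)" for n
  define J where "J n = fst (snd (s n))" for n
  define B where "B n = snd (snd (s n))" for n
  have s_eq: "s n = (I n, J n, B n)" for n by (simp add: I_def J_def B_def)
  have sp: "0 < I n" "I n \<le> J n" "J n < k" "B n \<in> \<P> k" "list_all2 (\<le>) (A n) (B n)"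
    "take (Suc (J n)) (B n) \<in> \<P> (J n)" "drop (I n) (B n) \<in> \<P> (k - I n)" for n
    using s(1)[of n] unfolding s_eq splits_iff[OF A] by auto
  have "range (\<lambda>n. (I n, J n)) \<subseteq> {..k} \<times> {..k}"
  proof clarsimp
    fix n show "I n \<le> k \<and> J n \<le> k" using sp(2,3)[of n] by simp
  qed
  then have "finite (range (\<lambda>n. (I n, J n)))" by (rule finite_subset) simp
  from constant_subseq[OF this] obtain r1 :: "nat \<Rightarrow> nat" and ij
    where "strict_mono r1" "\<forall>n. (I (r1 n), J (r1 n)) = ij" by blast
  moreover obtain i j where "ij = (i, j)" by (cases ij)
  ultimately have r1: "strict_mono r1" "\<And>n. I (r1 n) = i" "\<And>n. J (r1 n) = j" by auto
  have "0 \<le> B (r1 n) ! h \<and> B (r1 n) ! h \<le> 1" if "h < Suc k" for n h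
    using sp(4)[of "r1 n"] that by (auto simp: PP_iff)
  from coordinatewise_convergent_subseq[of "Suc k" "\<lambda>n h. B (r1 n) ! h", OF this]
  obtain r2 where r2: "strict_mono r2" "\<And>h. h < Suc k \<Longrightarrow> convergent (\<lambda>n. B (r1 (r2 n)) ! h)"
    by auto
  define r where "r = r1 \<circ> r2"
  have r: "strict_mono r" using r1(1) r2(1) by (simp add: r_def strict_mono_o)
  have Ir: "I (r n) = i" and Jr: "J (r n) = j" for n using r1 by (auto simp: r_def)
  define b where "b = map (\<lambda>h. lim (\<lambda>n. B (r n) ! h)) [0..<Suc k]"
  have lb: "length b = Suc k" by (simp add: b_def)
  have lB: "length (B n) = Suc k" and lA: "length (A n) = Suc k" and la: "length a = Suc k" for n
    using sp(4)[of n] A[of n] a by (auto simp: PP_iff)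
  have Bb: "(\<lambda>n. B (r n) ! h) \<longlonglongrightarrow> b ! h" if "h < Suc k" for h
    using r2(2)[OF that] that unfolding b_def r_def o_def
    by (subst nth_map) (auto simp: convergent_LIMSEQ_iff simp del: upt_Suc)
  have Ab: "(\<lambda>n. A (r n) ! h) \<longlonglongrightarrow> a ! h" if "h < Suc k" for h
    using LIMSEQ_subseq_LIMSEQ[OF Aa[OF that] r] by (simp add: o_def)
  have cr: "(\<lambda>n. c (r n)) \<longlonglongrightarrow> cl" using LIMSEQ_subseq_LIMSEQ[OF c r] by (simp add: o_def)
  have ij: "0 < i" "i \<le> j" "j < k" using sp(1-3)[of "r 0"] by (auto simp: Ir Jr)
  have closed: "x \<in> \<P> m"
    if X: "\<And>n. X n \<in> \<P> m" and Xx: "\<And>h. h < Suc m \<Longrightarrow> (\<lambda>n::nat. X n ! h) \<longlonglongrightarrow> x ! h"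
      and lx: "length x = Suc m" for X x m
  proof -
    have "0 \<le> x ! h \<and> x ! h \<le> 1" if "h < Suc m" for h
      using X that LIMSEQ_le_const[OF Xx[OF that], of 0] LIMSEQ_le_const2[OF Xx[OF that], of 1]
      by (auto simp: PP_iff)
    moreover have "(\<lambda>n. \<Sum>h<Suc m. X n ! h) \<longlonglongrightarrow> (\<Sum>h<Suc m. x ! h)"
      by (intro tendsto_sum Xx) auto
    then have "1 \<le> (\<Sum>h<Suc m. x ! h)"
      using X by (rule_tac LIMSEQ_le_const) (auto simp: PP_iff)
    ultimately show ?thesis using lx by (simp add: PP_iff)
  qed
  have b: "b \<in> \<P> k" using closed[OF sp(4) Bb lb] .
  have TB: "take (Suc j) (B (r n)) \<in> \<P> j" and DB: "drop i (B (r n)) \<in> \<P> (k - i)" for n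
    using sp(6,7)[of "r n"] by (auto simp: Ir Jr)
  have Tlim: "(\<lambda>n. take (Suc j) (B (r n)) ! h) \<longlonglongrightarrow> take (Suc j) b ! h" if "h < Suc j" for h
    using Bb[of h] that ij by simp
  have Dlim: "(\<lambda>n. drop i (B (r n)) ! h) \<longlonglongrightarrow> drop i b ! h" if "h < Suc (k - i)" for h
    using Bb[of "i + h"] that ij lb lB by simp
  have T: "take (Suc j) b \<in> \<P> j" using closed[OF TB Tlim] lb ij by simp
  have D: "drop i b \<in> \<P> (k - i)" using closed[OF DB Dlim] lb ij by simp
  have "a ! h \<le> b ! h" if "h < Suc k" for h
    using sp(5) that lA by (intro LIMSEQ_le[OF Ab[OF that] Bb[OF that]]) (auto simp: list_all2_conv_all_nth)
  then have "list_all2 (\<le>) a b" using la lb by (simp add: list_all2_conv_all_nth)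
  then have mem: "(i, j, b) \<in> splits a" using a b T D ij by (simp add: splits_iff)
  define N where "N n = (\<Sum>h<Suc k. B (r n) ! h - A (r n) ! h)" for n
  define x where "x n = c (r n) - N n" for n
  define xl where "xl = cl - sum_list (map2 (-) b a)"
  have "N \<longlonglongrightarrow> (\<Sum>h<Suc k. b ! h - a ! h)"
    unfolding N_def by (intro tendsto_sum tendsto_diff Bb Ab) auto
  then have x: "x \<longlonglongrightarrow> xl"
    unfolding x_def xl_def sum_list_map2_diff[OF la lb] by (intro tendsto_diff cr)
  have "N n + max (chi (take (Suc j) (B (r n)))) (chi (drop i (B (r n)))) \<le> c (r n)" for n
    using s(2)[of "r n"] unfolding s_eq split_cost_def N_def
    by (simp add: sum_list_map2_diff[OF lA lB] Ir Jr del: sum.lessThan_Suc)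
  then have xs: "chi (take (Suc j) (B (r n))) \<le> x n" "chi (drop i (B (r n))) \<le> x n" for n
    unfolding x_def by (smt (verit) max.cobounded1 max.cobounded2)+
  have "chi (take (Suc j) b) \<le> xl"
    by (rule chi_lscD[OF _ TB xs(1) T Tlim x]) (use lsc[of j] ij in simp_all)
  moreover have "chi (drop i b) \<le> xl"
    by (rule chi_lscD[OF _ DB xs(2) D Dlim x]) (use lsc[of "k - i"] ij in simp_all)
  ultimately have "split_cost a (i, j, b) \<le> cl" by (simp add: split_cost_def xl_def)
  with mem show ?thesis by blast
qed

lemma attained:
  assumes lsc: "\<And>m. 1 \<le> m \<Longrightarrow> m < k \<Longrightarrow> chi_lsc m" and a: "a \<in> \<P> k" and k: "k \<ge> 2"
  shows "\<exists>t\<in>splits a. split_cost a t = chi a"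
proof -
  define c where "c n = chi a + 1 / real (Suc n)" for n
  have "\<exists>t\<in>splits a. split_cost a t < c n" for n
  proof (rule ccontr)
    assume "\<not> ?thesis"
    then have "c n \<le> chi a"
      using splits_nonempty[OF a k]
      by (subst chi_step[OF a k]) (auto intro!: cINF_greatest simp: not_less)
    then show False by (simp add: c_def field_simps)
  qed
  then obtain s where s: "\<And>n. s n \<in> splits a" "\<And>n. split_cost a (s n) \<le> c n"
    by (metis less_imp_le)
  have "c \<longlonglongrightarrow> chi a + 0"
    unfolding c_def by (intro tendsto_add tendsto_const LIMSEQ_Suc[OF lim_1_over_n])
  then have "\<exists>t\<in>splits a. split_cost a t \<le> chi a"
    using splits_closed[of k "\<lambda>_. a" a s c "chi a"] lsc a s by auto
  then show ?thesis using chi_le[OF a k] by (metis antisym)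
qed

lemma chi_lsc: "k \<ge> 1 \<Longrightarrow> chi_lsc k"
proof (induction k rule: less_induct)
  case (less k)
  show ?case unfolding chi_lsc_def
  proof (intro allI impI)
    fix A a c cl
    assume A: "\<forall>n::nat. A n \<in> \<P> k \<and> chi (A n) \<le> c n" and a: "a \<in> \<P> k"
      and Aa: "\<forall>h<Suc k. (\<lambda>n. A n ! h) \<longlonglongrightarrow> a ! h" and c: "c \<longlonglongrightarrow> cl"
    show "chi a \<le> cl"
    proof (cases "k = 1")
      case True
      have "chi a = 0" using a True chi_base by simp
      moreover have "0 \<le> c n" for n using A True chi_base[of "A n"] by metis
      ultimately show ?thesis using LIMSEQ_le_const[OF c, of 0] by simp
    next
      case False
      then have k: "k \<ge> 2" using less.prems by simp
      have "\<exists>t\<in>splits (A n). split_cost (A n) t = chi (A n)" for n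
        using attained[OF _ _ k] less.IH A by blast
      then obtain s where s: "\<And>n. s n \<in> splits (A n)" "\<And>n. split_cost (A n) (s n) = chi (A n)"
        by metis
      then obtain t where "t \<in> splits a" "split_cost a t \<le> cl"
        using splits_closed[of k A a s c cl] less.IH A a Aa c by auto
      then show ?thesis using chi_le[OF a k] order_trans by blast
    qed
  qed
qed

theorem chi_minimum:
  assumes "a \<in> \<P> k" "k \<ge> 2"
  shows "(\<exists>t\<in>splits a. split_cost a t = chi a) \<and> (\<forall>t\<in>splits a. chi a \<le> split_cost a t)"
  using assms attained chi_lsc chi_le by blast

end

theory Submission
  imports Defs "HOL-Number_Theory.Fib"
begin

text \<open>
  Put weight 1/3 on each of three positions, the first and the last of them being the ends of the
  sequence, and let \<open>x\<close>, \<open>y\<close> be the two gaps. Adding one more weight 1/3 inside the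
  first gap, so that \<open>x = x' + x''\<close>, allows a split into the overlapping pieces with gaps
  \<open>(x', x'')\<close> and \<open>(x'', y)\<close>. With consecutive Fibonacci numbers as gaps both pieces
  are, up to reversal, of the same shape one Fibonacci step below, so a cost of 1/3 buys a factor
  \<open>\<phi>\<close> in length.
\<close>

text \<open>Specialises \<open>chi_le\<close> to splits that raise a single coordinate, the only
  kind used below.\<close>

lemma chi_raise_le:
  assumes a: "us @ s # vs \<in> \<P> k" and st: "s \<le> t" "t \<le> 1" and ij: "0 < i" "i \<le> j" "j < k"
    and L: "take (Suc j) (us @ t # vs) \<in> \<P> j" and R: "drop i (us @ t # vs) \<in> \<P> (k - i)"
  shows "chi (us @ s # vs)
    \<le> (t - s) + max (chi (take (Suc j) (us @ t # vs))) (chi (drop i (us @ t # vs)))"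
proof -
  have "us @ t # vs \<in> \<P> k" using a st by (auto simp: \<P>_def)
  moreover have "list_all2 (\<le>) (us @ s # vs) (us @ t # vs)"
    using st by (simp add: list_all2_appendI list_all2_refl)
  ultimately have "(i, j, us @ t # vs) \<in> splits (us @ s # vs)"
    using ij L R by (simp add: splits_iff[OF a])
  moreover have "sum_list (map2 (-) xs xs) = 0" for xs :: "real list"
    by (induction xs) auto
  then have "sum_list (map2 (-) (us @ t # vs) (us @ s # vs)) = t - s"
    by simp
  ultimately show ?thesis
    using chi_le[OF a, of "(i, j, us @ t # vs)"] ij by (simp add: split_cost_def)
qed

text \<open>The arguments count the zeros between the weights, so the gaps are \<open>p + 1\<close> and \<open>q + 1\<close>.\<close>

definition thirds :: "nat \<Rightarrow> nat \<Rightarrow> real list" where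
  "thirds p q = 1/3 # replicate p 0 @ 1/3 # replicate q 0 @ [1/3]"

lemma sum_list_thirds [simp]: "sum_list (thirds p q) = 1"
  by (simp add: thirds_def sum_list_replicate)

lemma thirds_in_P: "k = p + q + 2 \<Longrightarrow> thirds p q \<in> \<P> k"
  by (auto simp: \<P>_def thirds_def sum_list_replicate)

text \<open>With no zero available, the middle weight is raised to 2/3 instead; cutting there leaves
  two pairs of norm 1.\<close>

lemma chi_thirds_0_0: "chi (thirds 0 0) \<le> 1/3"
proof -
  have "chi ([1/3] @ 1/3 # [1/3]) \<le> (2/3 - 1/3)
      + max (chi (take (Suc 1) ([1/3] @ 2/3 # [1/3]))) (chi (drop 1 ([1/3] @ 2/3 # [1/3])))"
    by (rule chi_raise_le[where k = 2]) (auto simp: \<P>_def)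
  moreover have "chi [1/3, 2/3] = 0" "chi [2/3, 1/3] = 0"
    by (rule chi_base; simp add: \<P>_def)+
  ultimately show ?thesis by (simp add: thirds_def)
qed

text \<open>Setting the second or the third weight of \<open>b p q r\<close> to 0 gives the two
  left-hand sides. The pieces run up to the third weight and from the second, sharing the gap
  \<open>q\<close>. The mirrored version stands in for reversal symmetry of
  \<open>chi\<close>.\<close>

lemma chi_thirds_split:
  defines "b p q r \<equiv> (1/3 # replicate p 0 @ 1/3 # replicate q 0) @ 1/3 # replicate r 0 @ [1/3::real]"
  shows chi_thirds_split_left:
      "chi (thirds (p + Suc q) r) \<le> 1/3 + max (chi (thirds p q)) (chi (thirds q r))"
    and chi_thirds_split_right:
      "chi (thirds p (q + Suc r)) \<le> 1/3 + max (chi (thirds p q)) (chi (thirds q r))"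
proof -
  have T: "take (Suc (p + q + 2)) (b p q r) = thirds p q"
    by (simp add: b_def thirds_def)
  have D: "drop (Suc p) (b p q r) = thirds q r"
    by (simp add: b_def thirds_def)
  \<comment> \<open>Regrouped so that the second weight is the raised coordinate;
    \<open>b_def\<close> itself singles out the third.\<close>
  have b': "b p q r = (1/3 # replicate p 0) @ 1/3 # replicate q 0 @ 1/3 # replicate r 0 @ [1/3]"
    by (simp add: b_def)
  have P: "thirds p q \<in> \<P> (p + q + 2)" "thirds q r \<in> \<P> (p + q + r + 3 - Suc p)"
    by (auto intro: thirds_in_P)
  have left: "thirds (p + Suc q) r
      = (1/3 # replicate p 0) @ 0 # replicate q 0 @ 1/3 # replicate r 0 @ [1/3]"
    by (simp add: thirds_def replicate_add del: add_Suc_right)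
  show "chi (thirds (p + Suc q) r) \<le> 1/3 + max (chi (thirds p q)) (chi (thirds q r))"
    using chi_raise_le[of "1/3 # replicate p 0" 0 "replicate q 0 @ 1/3 # replicate r 0 @ [1/3]"
        "p + q + r + 3" "1/3" "Suc p" "p + q + 2", folded b' left, unfolded T D] P
      thirds_in_P[of "p + q + r + 3" "p + Suc q" r] by simp
  have right: "thirds p (q + Suc r)
      = (1/3 # replicate p 0 @ 1/3 # replicate q 0) @ 0 # replicate r 0 @ [1/3]"
    by (simp add: thirds_def replicate_add del: add_Suc_right)
  show "chi (thirds p (q + Suc r)) \<le> 1/3 + max (chi (thirds p q)) (chi (thirds q r))"
    using chi_raise_le[of "1/3 # replicate p 0 @ 1/3 # replicate q 0" 0 "replicate r 0 @ [1/3]"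
        "p + q + r + 3" "1/3" "Suc p" "p + q + 2", folded b_def right, unfolded T D] P
      thirds_in_P[of "p + q + r + 3" p "q + Suc r"] by simp
qed

text \<open>The new weight uses up one zero, so
  \<open>u + v = p - 1 \<le> (m - 1) + (n - 1)\<close>; choosing \<open>v\<close> as large as
  possible keeps \<open>u\<close> below \<open>m\<close>.\<close>

lemma less_add_obtain:
  fixes p :: nat
  assumes "p < m + n" "0 < p" "0 < m" "0 < n"
  obtains u v where "p = u + Suc v" "u < m" "v < n"
proof
  show "p = (p - 1 - min (p - 1) (n - 1)) + Suc (min (p - 1) (n - 1))" using assms by linarith
qed (use assms in linarith)+

text \<open>Upper bounds on the gaps, rather than exact Fibonacci values, cover every length. Both
  orientations go through the induction together, since the two pieces of a split have their longer
  bounds on opposite sides.\<close>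

lemma chi_thirds_fib:
  assumes "p < fib (n + 2)" "q < fib (n + 1)"
  shows "chi (thirds p q) \<le> (n + 1) / 3 \<and> chi (thirds q p) \<le> (n + 1) / 3"
  using assms
proof (induction n arbitrary: p q)
  case 0
  then show ?case using chi_thirds_0_0 by simp
next
  case (Suc n)
  have pos: "0 < fib (n + 2)" "0 < fib (n + 1)" by (simp_all add: fib_neq_0_nat)
  show ?case
  \<comment> \<open>Without a zero to replace there is no split, but then \<open>q\<close> can take
    the longer role one step below.\<close>
  proof (cases "p = 0")
    case True
    then have "chi (thirds q p) \<le> (n + 1) / 3 \<and> chi (thirds p q) \<le> (n + 1) / 3"
      using Suc.IH[of q p] Suc.prems pos by simp
    then show ?thesis by (auto simp: field_simps)
  next
    case False
    obtain u v where uv: "p = u + Suc v" "u < fib (n + 2)" "v < fib (n + 1)"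
      using less_add_obtain[of p "fib (n + 2)" "fib (n + 1)"] False Suc.prems pos by auto
    have q: "q < fib (n + 2)" using Suc.prems by simp
    note IH = Suc.IH[OF uv(2,3)] Suc.IH[OF q uv(3)]
    have "max (chi (thirds u v)) (chi (thirds v q)) \<le> (n + 1) / 3"
      by (intro max.boundedI) (use IH in auto)
    then have "chi (thirds p q) \<le> 1/3 + (n + 1) / 3"
      unfolding uv(1) using chi_thirds_split_left[of u v q] by linarith
    moreover have p: "p = v + Suc u" using uv(1) by simp
    have "max (chi (thirds q v)) (chi (thirds v u)) \<le> (n + 1) / 3"
      by (intro max.boundedI) (use IH in auto)
    then have "chi (thirds q p) \<le> 1/3 + (n + 1) / 3"
      unfolding p using chi_thirds_split_right[of q v u] by linarith
    ultimately show ?thesis by (auto simp: field_simps)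
  qed
qed

lemma golden_ratio_gt_1: "golden_ratio > 1"
  by (simp add: golden_ratio_def)

text \<open>Both sides obey the Fibonacci recursion, so comparing the first two values
  suffices.\<close>

lemma golden_ratio_power_le_fib: "golden_ratio ^ n \<le> fib (n + 2)"
proof (induction n rule: fib.induct)
  case 2
  have "sqrt 5 \<le> 3" by (rule real_le_lsqrt) auto
  then show ?case by (simp add: golden_ratio_def numeral_eq_Suc)
next
  case (3 n)
  have "golden_ratio ^ 2 = golden_ratio + 1"
    by (simp add: golden_ratio_def power2_eq_square field_simps)
  then have "golden_ratio ^ Suc (Suc n) = golden_ratio ^ Suc n + golden_ratio ^ n"
    by (simp add: power2_eq_square algebra_simps flip: mult.assoc)
  also have "\<dots> \<le> fib (Suc n + 2) + fib (n + 2)" using 3 by simp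
  finally show ?case by simp
qed simp

theorem theorem7p7:
  shows "\<exists>C::real. \<forall>k\<ge>(1::nat). \<exists>a\<in>\<P> k.
           chi a + sum_list a \<le> 1 / 3 * log golden_ratio (real k) + C"
proof (intro exI[of _ "4/3"] allI impI)
  fix k :: nat assume k: "k \<ge> 1"
  show "\<exists>a\<in>\<P> k. chi a + sum_list a \<le> 1 / 3 * log golden_ratio (real k) + 4/3"
  proof (cases "k = 1")
    case True
    \<comment> \<open>\<open>thirds\<close> has at least three entries, hence a separate
      witness.\<close>
    have "[1, 0] \<in> \<P> 1" by (simp add: \<P>_def)
    then show ?thesis using True by (intro bexI[of _ "[1, 0]"]) (auto simp: chi_base)
  next
    case False
    \<comment> \<open>The defining bound lets the gaps fit \<open>chi_thirds_fib\<close>; minimality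
      gives \<open>n \<le> log golden_ratio k\<close>.\<close>
    define n where "n = (LEAST n. k \<le> fib (n + 3))"
    obtain N where "k < golden_ratio ^ N" using real_arch_pow[OF golden_ratio_gt_1] by blast
    also have "\<dots> \<le> golden_ratio ^ Suc N" using golden_ratio_gt_1 by (intro power_increasing) auto
    also have "\<dots> \<le> fib (N + 3)"
      using golden_ratio_power_le_fib[of "Suc N"] by (simp add: numeral_eq_Suc)
    finally have "k \<le> fib (N + 3)" by simp
    then have n: "k \<le> fib (n + 3)" unfolding n_def by (rule LeastI)
    have "golden_ratio ^ n \<le> k"
    proof (cases n)
      case (Suc m)
      then have "fib (m + 3) < k" using not_less_Least[of m "\<lambda>n. k \<le> fib (n + 3)"]
        by (simp add: n_def)
      then show ?thesis using golden_ratio_power_le_fib[of n] Suc by (simp add: numeral_eq_Suc)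
    qed (use k in simp)
    then have log: "n \<le> log golden_ratio k"
      using golden_ratio_gt_1 k by (simp add: le_log_iff powr_realpow)
    have "k - 1 < fib (n + 2) + fib (n + 1)" using n k by (simp add: numeral_eq_Suc)
    \<comment> \<open>One of the \<open>k - 1\<close> inner positions carries the middle
      weight.\<close>
    then obtain p q where pq: "k - 1 = p + Suc q" "p < fib (n + 2)" "q < fib (n + 1)"
      using less_add_obtain[of "k - 1" "fib (n + 2)" "fib (n + 1)"] False k
      by (auto simp: fib_neq_0_nat)
    have "thirds p q \<in> \<P> k" using pq(1) k by (intro thirds_in_P) simp
    \<comment> \<open>The constant is the norm 1 plus the excess 1/3 of \<open>(n + 1) / 3\<close>
      over \<open>n / 3\<close>.\<close>
    moreover have "chi (thirds p q) + sum_list (thirds p q) \<le> 1 / 3 * log golden_ratio k + 4/3"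
      using chi_thirds_fib[OF pq(2,3)] log by (simp add: field_simps)
    ultimately show ?thesis by blast
  qed
qed

end
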